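(* Let $n\ge4$, let $\alpha\in\mathbb{R}$, and let $\boldsymbol{v}$ be a $C^1$ geodesible tangential vector field on $\mathbb{S}^{n-1}$ that is not identically zero. Then the following are equivalent: (a) there exist $C^1$ scalar functions $f,q$ on $\mathbb{S}^{n-1}$ such that, with $\rho=|\boldsymbol{x}|$ and $\boldsymbol{y}=\boldsymbol{x}/|\boldsymbol{x}|$, the pair $$\boldsymbol{u}(\boldsymbol{x})=\frac{1}{\rho^{\alpha}}\bigl(\boldsymbol{v}(\boldsymbol{y})+f(\boldsymbol{y})\boldsymbol{y}\bigr),\qquad p(\boldsymbol{x})=\frac{1}{\rho^{2\alpha}}q(\boldsymbol{y})$$ is a $(-\alpha)$-homogeneous geodesible solution of the steady Euler equations on $\mathbb{R}^n\setminus\{0\}$, that is, it satisfies $$\iota_{\boldsymbol{u}}du+d\Pi=0,\qquad \operatorname{div}\boldsymbol{u}=0,\qquad \Pi=p+\tfrac12|\boldsymbol{u}|^2,$$ together with $\iota_{\boldsymbol{u}}du=0$; (b) $\alpha=1$.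
   Context: $\mathbb{R}^n\setminus\{0\}$ carries the flat metric and $\mathbb{S}^{n-1}$ its standard round metric. $u=\boldsymbol{u}^{\flat}$ is the one-form dual to $\boldsymbol{u}$ in the flat metric; $v=\boldsymbol{v}^{\flat}$ is the one-form dual to $\boldsymbol{v}$ on $\mathbb{S}^{n-1}$. $d$ is the exterior derivative, $\iota$ is contraction, $\operatorname{div}_S$ is the divergence on $\mathbb{S}^{n-1}$. A divergence-free vector field $\boldsymbol{w}$ with dual one-form $w$ (on $\mathbb{R}^n\setminus\{0\}$ or on $\mathbb{S}^{n-1}$) is called geodesible if $\iota_{\boldsymbol{w}}dw=0$; it may have zeros. In particular $\boldsymbol{v}$ satisfies $\iota_{\boldsymbol{v}}dv=0$ and $\operatorname{div}_S\boldsymbol{v}=0$. *)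

theory Defs
  imports "HOL-Analysis.Analysis"
begin

section \<open>Calculus on open subsets of Euclidean space\<close>

text \<open>One-forms are functions of a base point and a tangent vector, two-forms of a base point
  and two tangent vectors.\<close>

type_synonym 'a one_form = "'a \<Rightarrow> 'a \<Rightarrow> real"
type_synonym 'a two_form = "'a \<Rightarrow> 'a \<Rightarrow> 'a \<Rightarrow> real"

definition C1_on :: "('a::euclidean_space \<Rightarrow> 'b::real_normed_vector) \<Rightarrow> 'a set \<Rightarrow> bool" where
  "C1_on F U \<longleftrightarrow> (\<exists>F' :: 'a \<Rightarrow> 'a \<Rightarrow>\<^sub>L 'b.
     (\<forall>x\<in>U. (F has_derivative blinfun_apply (F' x)) (at x)) \<and> continuous_on U F')"

definition flat :: "('a::real_inner \<Rightarrow> 'a) \<Rightarrow> 'a one_form" where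
  "flat w x \<xi> = w x \<bullet> \<xi>"

definition contraction :: "('a \<Rightarrow> 'a) \<Rightarrow> 'a two_form \<Rightarrow> 'a one_form" where
  "contraction w \<beta> x \<xi> = \<beta> x (w x) \<xi>"

definition differential :: "('a::euclidean_space \<Rightarrow> real) \<Rightarrow> 'a one_form" where
  "differential h x = frechet_derivative h (at x)"

text \<open>The formula \<open>d\<omega>(X,Y) = X(\<omega>(Y)) - Y(\<omega>(X)) - \<omega>([X,Y])\<close> for constant
  vector fields \<open>X = \<xi>\<close> and \<open>Y = \<eta>\<close>, whose bracket vanishes.\<close>

definition ext_d :: "'a::euclidean_space one_form \<Rightarrow> 'a two_form" where
  "ext_d \<omega> x \<xi> \<eta> =
     frechet_derivative (\<lambda>z. \<omega> z \<eta>) (at x) \<xi> - frechet_derivative (\<lambda>z. \<omega> z \<xi>) (at x) \<eta>"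

definition pullback :: "('a::euclidean_space \<Rightarrow> 'a) \<Rightarrow> 'a one_form \<Rightarrow> 'a one_form" where
  "pullback \<phi> \<omega> x \<xi> = \<omega> (\<phi> x) (frechet_derivative \<phi> (at x) \<xi>)"

definition divergence :: "('a::euclidean_space \<Rightarrow> 'a) \<Rightarrow> 'a \<Rightarrow> real" where
  "divergence w x = (\<Sum>b\<in>Basis. frechet_derivative w (at x) b \<bullet> b)"

definition geodesible_on :: "'a::euclidean_space set \<Rightarrow> ('a \<Rightarrow> 'a) \<Rightarrow> bool" where
  "geodesible_on U w \<longleftrightarrow>
     (\<forall>x\<in>U. divergence w x = 0) \<and>
     (\<forall>x\<in>U. \<forall>\<xi>. contraction w (ext_d (flat w)) x \<xi> = 0)"

definition bernoulli :: "('a::real_inner \<Rightarrow> 'a) \<Rightarrow> ('a \<Rightarrow> real) \<Rightarrow> 'a \<Rightarrow> real" where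
  "bernoulli u p x = p x + (1/2) * (norm (u x))\<^sup>2"

text \<open>Solutions are classical: the derivatives occurring in the equations exist.\<close>

definition steady_euler_on ::
    "'a::euclidean_space set \<Rightarrow> ('a \<Rightarrow> 'a) \<Rightarrow> ('a \<Rightarrow> real) \<Rightarrow> bool" where
  "steady_euler_on U u p \<longleftrightarrow>
     C1_on u U \<and> C1_on p U \<and>
     (\<forall>x\<in>U. \<forall>\<xi>. contraction u (ext_d (flat u)) x \<xi> + differential (bernoulli u p) x \<xi> = 0) \<and>
     (\<forall>x\<in>U. divergence u x = 0)"

section \<open>Calculus on the unit sphere\<close>

text \<open>Functions, vector fields and forms on the unit sphere are represented by functions on the
  ambient space whose values off the sphere (and, for forms, on non-tangent vectors) are never
  used.  The radial projection onto the sphere is \<^term>\<open>sgn\<close>, as \<open>sgn x = x /\<^sub>R norm x\<close>;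
  it is smooth away from the origin and is the identity on the sphere.\<close>

abbreviation unit_sphere :: "'a::euclidean_space set" where
  "unit_sphere \<equiv> sphere 0 1"

definition sphere_tangent :: "'a::euclidean_space \<Rightarrow> 'a set" where
  "sphere_tangent y = {\<xi>. \<xi> \<bullet> y = 0}"

definition tangent_proj :: "'a::euclidean_space \<Rightarrow> 'a \<Rightarrow> 'a" where
  "tangent_proj y \<xi> = \<xi> - (\<xi> \<bullet> y) *\<^sub>R y"

text \<open>The usual notion of a \<open>C\<^sup>1\<close> map on a subset: locally the restriction of a \<open>C\<^sup>1\<close> map
  on an open set.\<close>

definition C1_on_sphere :: "('a::euclidean_space \<Rightarrow> 'b::real_normed_vector) \<Rightarrow> bool" where
  "C1_on_sphere F \<longleftrightarrow>
     (\<forall>y\<in>unit_sphere. \<exists>U G. open U \<and> y \<in> U \<and> C1_on G U \<and> (\<forall>x\<in>U \<inter> unit_sphere. G x = F x))"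

definition tangential :: "('a::euclidean_space \<Rightarrow> 'a) \<Rightarrow> bool" where
  "tangential v \<longleftrightarrow> (\<forall>y\<in>unit_sphere. v y \<in> sphere_tangent y)"

text \<open>With \<open>i\<close> the inclusion of the sphere and \<open>\<pi>\<close> the radial projection, \<open>\<pi> \<circ> i = id\<close>,
  so by naturality of \<open>d\<close> the exterior derivative on the sphere is \<open>i\<^sup>* d (\<pi>\<^sup>* \<omega>)\<close>.
  It is to be evaluated at points of the sphere on tangent vectors only.\<close>

definition sphere_ext_d :: "'a::euclidean_space one_form \<Rightarrow> 'a two_form" where
  "sphere_ext_d \<omega> = ext_d (pullback sgn \<omega>)"

text \<open>The Levi-Civita connection of the round metric is the tangential part of the ambient
  derivative.  For tangent \<open>\<xi>\<close>, the derivative of the radially constant extension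
  \<open>v \<circ> sgn\<close> along \<open>\<xi>\<close> is the derivative of \<open>v\<close> along \<open>\<xi>\<close>.\<close>

definition sphere_cov_deriv :: "('a::euclidean_space \<Rightarrow> 'a) \<Rightarrow> 'a \<Rightarrow> 'a \<Rightarrow> 'a" where
  "sphere_cov_deriv v y \<xi> = tangent_proj y (frechet_derivative (\<lambda>x. v (sgn x)) (at y) \<xi>)"

text \<open>The divergence is the trace of \<open>\<xi> \<mapsto> \<nabla>\<^sub>\<xi> v\<close> on the tangent space, computed as the
  ambient trace after extending this endomorphism by zero on the normal line.\<close>

definition sphere_divergence :: "('a::euclidean_space \<Rightarrow> 'a) \<Rightarrow> 'a \<Rightarrow> real" where
  "sphere_divergence v y = (\<Sum>b\<in>Basis. sphere_cov_deriv v y (tangent_proj y b) \<bullet> b)"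

definition sphere_geodesible :: "('a::euclidean_space \<Rightarrow> 'a) \<Rightarrow> bool" where
  "sphere_geodesible v \<longleftrightarrow>
     (\<forall>y\<in>unit_sphere. sphere_divergence v y = 0) \<and>
     (\<forall>y\<in>unit_sphere. \<forall>\<xi>\<in>sphere_tangent y. contraction v (sphere_ext_d (flat v)) y \<xi> = 0)"

end

(* Write u for the homogeneous field, extend v and f to be radially constant, and let a denote
   the degree exponent.  At unit length the radial component of the contraction of du with u is
   df(v) - (1 - a) |v|^2, so a geodesible u forces df(v) = (1 - a) |v|^2 on the sphere.
   As div v = 0, this says div (f v) = (1 - a) |v|^2, and integrating over the sphere gives
   (1 - a) times the integral of |v|^2 = 0, hence a = 1.
   The integration is carried out in the ambient space: f v is multiplied by a radial cutoff,
   and the integral of the divergence of a compactly supported C^1 field vanishes because Lebesgue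
   measure is translation invariant (dominated convergence of difference quotients).
   Conversely, for a = 1 one takes f = 0 and q = - |v|^2 / 2, so that the Bernoulli function
   vanishes. *)

theory Submission
  imports Defs
begin

section \<open>Continuously differentiable maps\<close>

lemma has_derivative_frechet:
  "f differentiable at x \<Longrightarrow> (f has_derivative frechet_derivative f (at x)) (at x)"
  by (simp add: frechet_derivative_works)

text \<open>In finite dimension, convergence of linear maps in operator norm is convergence on a
  basis. This trades the bounded linear functions in the definition for directional derivatives,
  which the later closure proofs can check one at a time.\<close>

lemma C1_on_iff:
  fixes F :: "'a::euclidean_space \<Rightarrow> 'b::real_normed_vector"
  shows "C1_on F U \<longleftrightarrow> (\<forall>x\<in>U. F differentiable at x) \<and>
    (\<forall>b\<in>Basis. continuous_on U (\<lambda>x. frechet_derivative F (at x) b))"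
proof
  assume "C1_on F U"
  then obtain F' where F': "\<And>x. x \<in> U \<Longrightarrow> (F has_derivative blinfun_apply (F' x)) (at x)"
    and cont: "continuous_on U F'"
    unfolding C1_on_def by blast
  have "continuous_on U (\<lambda>x. frechet_derivative F (at x) b)" for b
  proof -
    have "continuous_on U (\<lambda>x. blinfun_apply (F' x) b)"
      by (intro continuous_intros cont)
    then show ?thesis
      by (rule continuous_on_eq) (simp add: frechet_derivative_at[OF F', symmetric])
  qed
  then show "(\<forall>x\<in>U. F differentiable at x) \<and>
    (\<forall>b\<in>Basis. continuous_on U (\<lambda>x. frechet_derivative F (at x) b))"
    using F' differentiable_def by blast
next
  assume *: "(\<forall>x\<in>U. F differentiable at x) \<and>
    (\<forall>b\<in>Basis. continuous_on U (\<lambda>x. frechet_derivative F (at x) b))"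
  \<comment> \<open>Off \<open>U\<close> this value may be junk, since \<open>Blinfun\<close> is
    only meaningful on bounded linear maps; only points of \<open>U\<close> are used.\<close>
  define F' where "F' x = Blinfun (frechet_derivative F (at x))" for x
  have F': "blinfun_apply (F' x) = frechet_derivative F (at x)" if "x \<in> U" for x
    unfolding F'_def using * that
    by (meson bounded_linear_Blinfun_apply has_derivative_bounded_linear has_derivative_frechet)
  have "continuous_on U F'"
    by (rule continuous_on_blinfun_componentwise) (use * F' in \<open>simp cong: continuous_on_cong_simp\<close>)
  moreover have "\<forall>x\<in>U. (F has_derivative blinfun_apply (F' x)) (at x)"
    using * by (simp add: F' has_derivative_frechet)
  ultimately show "C1_on F U"
    unfolding C1_on_def by blast
qed

lemma C1_onI:
  assumes "\<And>x. x \<in> U \<Longrightarrow> (F has_derivative F' x) (at x)"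
    and "\<And>b. b \<in> Basis \<Longrightarrow> continuous_on U (\<lambda>x. F' x b)"
  shows "C1_on F U"
  unfolding C1_on_iff
proof (intro conjI ballI)
  show "F differentiable at x" if "x \<in> U" for x
    using assms(1)[OF that] by (auto simp: differentiable_def)
  show "continuous_on U (\<lambda>x. frechet_derivative F (at x) b)" if "b \<in> Basis" for b
    using assms(2)[OF that] by (rule continuous_on_eq) (simp add: frechet_derivative_at[OF assms(1), symmetric])
qed

lemma C1_on_differentiable: "C1_on F U \<Longrightarrow> x \<in> U \<Longrightarrow> F differentiable at x"
  by (simp add: C1_on_iff)

lemma C1_on_has_derivative:
  "C1_on F U \<Longrightarrow> x \<in> U \<Longrightarrow> (F has_derivative frechet_derivative F (at x)) (at x)"
  by (simp add: C1_on_differentiable has_derivative_frechet)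

lemma C1_on_continuous_on: "C1_on F U \<Longrightarrow> continuous_on U F"
  by (meson C1_on_differentiable continuous_at_imp_continuous_on differentiable_imp_continuous_within)

lemma C1_on_continuous_frechet:
  fixes F :: "'a::euclidean_space \<Rightarrow> 'b::real_normed_vector"
  assumes "C1_on F U"
  shows "continuous_on U (\<lambda>x. frechet_derivative F (at x) b)"
proof -
  obtain F' where F': "\<And>x. x \<in> U \<Longrightarrow> (F has_derivative blinfun_apply (F' x)) (at x)"
    and cont: "continuous_on U F'"
    using assms unfolding C1_on_def by blast
  have "continuous_on U (\<lambda>x. blinfun_apply (F' x) b)"
    by (intro continuous_intros cont)
  then show ?thesis
    by (rule continuous_on_eq) (simp add: frechet_derivative_at[OF F', symmetric])
qed

section \<open>Closure properties of continuously differentiable maps\<close>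

lemma C1_on_compose:
  fixes g :: "'a::euclidean_space \<Rightarrow> 'b::euclidean_space" and f :: "'b \<Rightarrow> 'c::real_normed_vector"
  assumes f: "C1_on f T" and g: "C1_on g S" and sub: "g ` S \<subseteq> T"
  shows "C1_on (\<lambda>x. f (g x)) S"
proof -
  obtain f' where f': "\<And>x. x \<in> T \<Longrightarrow> (f has_derivative blinfun_apply (f' x)) (at x)"
    and contf: "continuous_on T f'"
    using f unfolding C1_on_def by blast
  show ?thesis
  proof (rule C1_onI)
    show "((\<lambda>x. f (g x)) has_derivative
        (\<lambda>\<xi>. blinfun_apply (f' (g x)) (frechet_derivative g (at x) \<xi>))) (at x)" if "x \<in> S" for x
    proof (rule has_derivative_compose[where g = f])
      show "(g has_derivative frechet_derivative g (at x)) (at x)"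
        by (rule C1_on_has_derivative[OF g that])
      show "(f has_derivative blinfun_apply (f' (g x))) (at (g x))"
        using f' sub that by blast
    qed
    \<comment> \<open>The direction fed to \<open>f'\<close> moves with \<open>x\<close>, so
      continuity of \<open>f'\<close> along fixed directions would not do directly; joint continuity
      of operator application is used.\<close>
    have "continuous_on S (\<lambda>x. f' (g x))"
      by (rule continuous_on_compose2[OF contf C1_on_continuous_on[OF g] sub])
    then show "continuous_on S (\<lambda>x. blinfun_apply (f' (g x)) (frechet_derivative g (at x) b))" for b
      by (intro bounded_bilinear.continuous_on[OF bounded_bilinear_blinfun_apply]
        C1_on_continuous_frechet[OF g])
  qed
qed

text \<open>A single Leibniz rule that yields scaling, inner products and multiplication at
  once.\<close>

lemma C1_on_bilinear:
  assumes "bounded_bilinear h" and f: "C1_on f U" and g: "C1_on g U"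
  shows "C1_on (\<lambda>x. h (f x) (g x)) U"
proof (rule C1_onI)
  interpret bounded_bilinear h by fact
  show "((\<lambda>x. h (f x) (g x)) has_derivative
      (\<lambda>\<xi>. h (f x) (frechet_derivative g (at x) \<xi>) + h (frechet_derivative f (at x) \<xi>) (g x))) (at x)"
    if "x \<in> U" for x
    by (intro FDERIV C1_on_has_derivative[OF f that] C1_on_has_derivative[OF g that])
  show "continuous_on U (\<lambda>x. h (f x) (frechet_derivative g (at x) b) + h (frechet_derivative f (at x) b) (g x))"
    for b
    by (intro continuous_on_add continuous_on C1_on_continuous_on[OF f] C1_on_continuous_on[OF g]
      C1_on_continuous_frechet[OF f] C1_on_continuous_frechet[OF g])
qed

lemmas C1_on_scaleR = C1_on_bilinear[OF bounded_bilinear_scaleR]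
lemmas C1_on_inner = C1_on_bilinear[OF bounded_bilinear_inner]
lemmas C1_on_mult = C1_on_bilinear[OF bounded_bilinear_mult]

lemma C1_on_const: "C1_on (\<lambda>x. c) U"
  by (rule C1_onI[where F' = "\<lambda>_ _. 0"]) auto

lemma C1_on_cong:
  assumes F: "C1_on F U" and "open U" and eq: "\<And>x. x \<in> U \<Longrightarrow> F x = G x"
  shows "C1_on G U"
proof (rule C1_onI)
  show "(G has_derivative frechet_derivative F (at x)) (at x)" if "x \<in> U" for x
    using C1_on_has_derivative[OF F that] \<open>open U\<close> that eq
    by (rule has_derivative_transform_within_open)
qed (use C1_on_continuous_frechet[OF F] in auto)

lemma C1_on_subset: "C1_on F U \<Longrightarrow> V \<subseteq> U \<Longrightarrow> C1_on F V"
  unfolding C1_on_iff by (meson continuous_on_subset subsetD)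

lemma C1_on_locally:
  assumes "\<And>x. x \<in> U \<Longrightarrow> \<exists>T. open T \<and> x \<in> T \<and> C1_on F T"
  shows "C1_on F U"
  unfolding C1_on_iff
proof (intro conjI ballI)
  show "F differentiable at x" if "x \<in> U" for x
    using assms[OF that] C1_on_differentiable by blast
  show "continuous_on U (\<lambda>x. frechet_derivative F (at x) b)" for b
  proof (intro continuous_at_imp_continuous_on ballI)
    fix x assume "x \<in> U"
    then obtain T where "open T" "x \<in> T" "C1_on F T"
      using assms by blast
    then show "isCont (\<lambda>x. frechet_derivative F (at x) b) x"
      using C1_on_continuous_frechet[of F T b] continuous_on_eq_continuous_at by blast
  qed
qed

section \<open>The integral of a divergence\<close>

text \<open>By translation invariance every difference quotient of \<open>w\<close> in direction
  \<open>e\<close> has integral zero. The quotients converge to the derivative and are dominated by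
  a Lipschitz constant times the indicator of a ball, so the limit also has integral zero.\<close>

lemma integral_frechet_derivative_eq_0:
  fixes w :: "'a::euclidean_space \<Rightarrow> real"
  assumes w: "C1_on w UNIV" and supp: "\<And>x. norm x > R \<Longrightarrow> w x = 0"
  shows "integrable lborel (\<lambda>x. frechet_derivative w (at x) e)"
    and "(\<integral>x. frechet_derivative w (at x) e \<partial>lborel) = 0"
proof -
  obtain D where D: "\<And>x. (w has_derivative blinfun_apply (D x)) (at x)" and contD: "continuous_on UNIV D"
    using w unfolding C1_on_def by auto
  have D_eq: "frechet_derivative w (at x) = blinfun_apply (D x)" for x
    using frechet_derivative_at[OF D] by simp
  have D0: "D x = 0" if "norm x > R" for x
  proof -
    have "open {z :: 'a. norm z > R}"
      by (intro open_Collect_less continuous_intros)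
    then have "(w has_derivative (\<lambda>_. 0)) (at x)"
      using that supp by (intro has_derivative_transform_within_open[OF has_derivative_const]) auto
    then have "blinfun_apply (D x) = (\<lambda>_. 0)"
      using has_derivative_unique[OF D] by blast
    then show ?thesis
      by (intro blinfun_eqI) simp
  qed
  have "compact ((\<lambda>x. norm (D x)) ` cball 0 R)"
    by (intro compact_continuous_image continuous_intros continuous_on_subset[OF contD]) auto
  then have "bounded ((\<lambda>x. norm (D x)) ` cball 0 R)"
    by (rule compact_imp_bounded)
  then obtain B0 where B0: "\<And>x. x \<in> cball 0 R \<Longrightarrow> norm (D x) \<le> B0"
    unfolding bounded_iff by force
  \<comment> \<open>For negative \<open>R\<close> the ball is empty and \<open>B0\<close> is
    arbitrary; the maximum keeps the bound nonnegative, as is also needed outside the ball, where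
    \<open>D\<close> vanishes.\<close>
  define B where "B = max 0 B0"
  have B: "norm (D x) \<le> B" for x
    using B0[of x] D0[of x] by (cases "norm x > R") (auto simp: B_def)
  have "B \<ge> 0" by (simp add: B_def)
  have lip: "norm (w x - w y) \<le> B * norm (x - y)" for x y
    by (rule differentiable_bound[of UNIV]) (use D B in \<open>auto simp: norm_blinfun.rep_eq\<close>)
  define h where "h n = inverse (real (Suc n))" for n
  have h: "0 < h n" "h n \<le> 1" for n
    by (auto simp: h_def field_simps)
  define s where "s n x = (w (h n *\<^sub>R e + x) - w x) / h n" for n x
  \<comment> \<open>Since \<open>h n \<le> 1\<close>, a translation moves points by at most
    \<open>norm e\<close>, so all quotients vanish outside this enlarged ball.\<close>
  define K where "K x = B * norm e * indicator (cball 0 (R + norm e)) x" for x :: 'a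
  have contw: "continuous_on UNIV w"
    by (rule C1_on_continuous_on[OF w])
  have [measurable]: "w \<in> borel_measurable borel"
    using contw by (rule borel_measurable_continuous_onI)
  have s_meas: "s n \<in> borel_measurable lborel" for n
    unfolding s_def by measurable
  have f_meas: "(\<lambda>x. blinfun_apply (D x) e) \<in> borel_measurable lborel"
  proof -
    have "continuous_on UNIV (\<lambda>x. blinfun_apply (D x) e)"
      by (intro continuous_intros contD)
    then have "(\<lambda>x. blinfun_apply (D x) e) \<in> borel_measurable borel"
      by (rule borel_measurable_continuous_onI)
    then show ?thesis by simp
  qed
  have K_int: "integrable lborel K"
    unfolding K_def
    by (intro integrable_mult_right integrable_real_indicator emeasure_compact_finite compact_cball) simp
  have bound: "norm (s n x) \<le> K x" for n x
  proof (cases "x \<in> cball 0 (R + norm e)")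
    case True
    have "norm (w (h n *\<^sub>R e + x) - w x) \<le> B * (h n * norm e)"
      using lip[of "h n *\<^sub>R e + x" x] h[of n] by simp
    then show ?thesis
      using True h[of n] by (simp add: s_def K_def field_simps)
  next
    case False
    have "norm (h n *\<^sub>R e) \<le> norm e"
      using h[of n] mult_right_mono[of "h n" 1 "norm e"] by simp
    moreover have "norm x \<le> norm (h n *\<^sub>R e + x) + norm (h n *\<^sub>R e)"
      using norm_triangle_ineq4[of "h n *\<^sub>R e + x" "h n *\<^sub>R e"] by simp
    ultimately have "norm (h n *\<^sub>R e + x) > R"
      using False by simp
    moreover have "norm x > R"
      using False norm_ge_zero[of e] by (simp only: mem_cball_0 not_le)
    ultimately show ?thesis
      using supp False by (simp add: s_def K_def)
  qed
  have lim: "(\<lambda>n. s n x) \<longlonglongrightarrow> blinfun_apply (D x) e" for x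
  proof -
    have "((\<lambda>t. w (t *\<^sub>R e + x)) has_derivative (\<lambda>t. blinfun_apply (D x) (t *\<^sub>R e))) (at 0)"
      by (rule has_derivative_compose[where g = w and f = "\<lambda>t. t *\<^sub>R e + x"])
        (use D in \<open>auto intro!: derivative_eq_intros\<close>)
    then have "((\<lambda>t. w (t *\<^sub>R e + x)) has_real_derivative blinfun_apply (D x) e) (at 0)"
      by (simp add: has_field_derivative_def blinfun.scaleR_right mult_commute_abs)
    then have "((\<lambda>t. (w (t *\<^sub>R e + x) - w x) / t) \<longlongrightarrow> blinfun_apply (D x) e) (at 0)"
      by (simp add: DERIV_def)
    moreover have "filterlim h (at 0) sequentially"
      unfolding h_def using LIMSEQ_inverse_real_of_nat
      by (intro filterlim_atI) auto
    ultimately show ?thesis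
      unfolding s_def by (rule filterlim_compose)
  qed
  have w_int: "integrable lborel w"
  proof -
    have "(\<lambda>x. indicator (cball 0 R) x *\<^sub>R w x) = w"
      using supp by (fastforce simp: indicator_def)
    moreover have "integrable lborel (\<lambda>x. indicator (cball 0 R) x *\<^sub>R w x)"
      by (intro borel_integrable_compact compact_cball continuous_on_subset[OF contw]) simp
    ultimately show ?thesis by simp
  qed
  have s_int: "integral\<^sup>L lborel (s n) = 0" for n
  proof -
    have "integrable lborel (\<lambda>x. w (h n *\<^sub>R e + x))"
      using integrable_distr_eq[of "(+) (h n *\<^sub>R e)" lborel borel w] w_int
      by (simp add: lborel_distr_plus)
    moreover have "(\<integral>x. w (h n *\<^sub>R e + x) \<partial>lborel) = integral\<^sup>L lborel w"
      using integral_distr[of "(+) (h n *\<^sub>R e)" lborel borel w]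
      by (simp add: lborel_distr_plus)
    ultimately show ?thesis
      unfolding s_def using w_int by simp
  qed
  show "integrable lborel (\<lambda>x. frechet_derivative w (at x) e)"
    unfolding D_eq
    by (rule integrable_dominated_convergence[OF f_meas s_meas K_int AE_I2 AE_I2]) (rule lim bound)+
  have "(\<lambda>n. integral\<^sup>L lborel (s n)) \<longlonglongrightarrow> (\<integral>x. blinfun_apply (D x) e \<partial>lborel)"
    by (rule integral_dominated_convergence[OF f_meas s_meas K_int AE_I2 AE_I2]) (rule lim bound)+
  then show "(\<integral>x. frechet_derivative w (at x) e \<partial>lborel) = 0"
    unfolding D_eq s_int by (simp add: LIMSEQ_const_iff)
qed

lemma frechet_derivative_inner_left:
  fixes w :: "'a::real_normed_vector \<Rightarrow> 'b::real_inner"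
  assumes "w differentiable at x"
  shows "frechet_derivative (\<lambda>z. w z \<bullet> c) (at x) \<xi> = frechet_derivative w (at x) \<xi> \<bullet> c"
proof -
  have "((\<lambda>z. w z \<bullet> c) has_derivative (\<lambda>\<xi>. frechet_derivative w (at x) \<xi> \<bullet> c)) (at x)"
    by (intro has_derivative_inner_left has_derivative_frechet assms)
  from frechet_derivative_at[OF this, symmetric] show ?thesis by simp
qed

text \<open>Each summand of the divergence is a partial derivative of a compactly supported scalar
  component.\<close>

lemma integral_divergence_eq_0:
  fixes w :: "'a::euclidean_space \<Rightarrow> 'a"
  assumes w: "C1_on w UNIV" and supp: "\<And>x. norm x > R \<Longrightarrow> w x = 0"
  shows "integrable lborel (divergence w)" and "integral\<^sup>L lborel (divergence w) = 0"
proof -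
  have C1: "C1_on (\<lambda>x. w x \<bullet> b) UNIV" for b
    by (rule C1_on_inner[OF w C1_on_const])
  have div: "divergence w = (\<lambda>x. \<Sum>b\<in>Basis. frechet_derivative (\<lambda>z. w z \<bullet> b) (at x) b)"
    unfolding divergence_def
    using C1_on_differentiable[OF w] by (simp add: frechet_derivative_inner_left)
  have supp': "w x \<bullet> b = 0" if "norm x > R" for x b
    using supp[OF that] by simp
  note int = integral_frechet_derivative_eq_0[OF C1 supp']
  show "integrable lborel (divergence w)"
    unfolding div by (rule Bochner_Integration.integrable_sum) (rule int(1))
  show "integral\<^sup>L lborel (divergence w) = 0"
    unfolding div by (subst Bochner_Integration.integral_sum) (simp_all only: int sum.neutral_const)
qed

text \<open>A nonnegative function with zero integral vanishes almost everywhere, and the part of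
  \<open>U\<close> where it does not vanish is open, hence empty. Restricting to \<open>U\<close>
  allows for integrands built from radial extensions, whose regularity is known away from the
  origin.\<close>

lemma continuous_integral_eq_0_imp_eq_0:
  fixes g :: "'a::euclidean_space \<Rightarrow> real"
  assumes "integrable lborel g" and "integral\<^sup>L lborel g = 0" and nonneg: "\<And>x. g x \<ge> 0"
    and "open U" and cont: "continuous_on U g" and "x \<in> U"
  shows "g x = 0"
proof (rule ccontr)
  assume "g x \<noteq> 0"
  have "AE x in lborel. g x = 0"
    using assms(1,2) nonneg integral_nonneg_eq_0_iff_AE[of lborel g] by simp
  then have "AE x in lebesgue. g x = 0"
    by (rule AE_completion)
  then obtain N where "N \<in> null_sets lebesgue" "{x. g x \<noteq> 0} \<subseteq> N"
    unfolding eventually_ae_filter by auto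
  then have "negligible {x. g x \<noteq> 0}"
    by (meson negligible_iff_null_sets negligible_subset)
  then have "negligible (U \<inter> g -` (- {0}))"
    by (rule negligible_subset) auto
  moreover have "open (U \<inter> g -` (- {0}))"
    using cont \<open>open U\<close> by (intro continuous_open_preimage) auto
  moreover have "x \<in> U \<inter> g -` (- {0})"
    using \<open>x \<in> U\<close> \<open>g x \<noteq> 0\<close> by simp
  ultimately show False
    using open_not_negligible by blast
qed

section \<open>Radially constant extensions\<close>

lemma has_derivative_sgn:
  fixes x :: "'a::euclidean_space"
  assumes "x \<noteq> 0"
  shows "(sgn has_derivative (\<lambda>\<xi>. tangent_proj (sgn x) \<xi> /\<^sub>R norm x)) (at x)"
proof -
  have "((\<lambda>x. inverse (norm x) *\<^sub>R x) has_derivative (\<lambda>\<xi>. tangent_proj (sgn x) \<xi> /\<^sub>R norm x)) (at x)"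
    using assms
    by (auto intro!: derivative_eq_intros has_derivative_norm
      simp: tangent_proj_def sgn_div_norm algebra_simps inner_commute)
  then show ?thesis
    by (simp add: sgn_div_norm[abs_def])
qed

lemma sgn_idem [simp]: "sgn (sgn x) = sgn (x :: 'a::real_normed_vector)"
  by (cases "x = 0") (simp_all add: sgn_div_norm)

lemma C1_on_sgn: "C1_on (sgn :: 'a::euclidean_space \<Rightarrow> 'a) (- {0})"
proof (rule C1_onI[OF has_derivative_sgn])
  show "continuous_on (- {0}) (\<lambda>x :: 'a. tangent_proj (sgn x) b /\<^sub>R norm x)" for b
    unfolding tangent_proj_def by (intro continuous_intros continuous_on_sgn) auto
qed auto

lemma C1_on_norm_powr: "C1_on (\<lambda>x :: 'a::euclidean_space. norm x powr a) (- {0})"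
proof (rule C1_onI)
  show "((\<lambda>x. norm x powr a) has_derivative
      (\<lambda>\<xi>. norm x powr a * ((\<xi> \<bullet> sgn x) * a / norm x))) (at x)" if "x \<in> - {0}" for x :: 'a
    using that by (auto intro!: derivative_eq_intros has_derivative_norm simp: inner_commute)
  show "continuous_on (- {0}) (\<lambda>x :: 'a. norm x powr a * ((b \<bullet> sgn x) * a / norm x))" for b
    by (intro continuous_intros continuous_on_sgn) auto
qed

text \<open>This passes from the sphere to the punctured space: near \<open>x\<close> the extension
  agrees with a local ambient extension \<open>G\<close> composed with \<open>sgn\<close>, on the
  open preimage of the domain of \<open>G\<close>.\<close>

lemma C1_on_radial_extension:
  fixes g :: "'a::euclidean_space \<Rightarrow> 'b::real_normed_vector"
  assumes "C1_on_sphere g"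
  shows "C1_on (\<lambda>x. g (sgn x)) (- {0})"
proof (rule C1_on_locally)
  fix x :: 'a assume "x \<in> - {0}"
  then have "sgn x \<in> unit_sphere"
    by (simp add: norm_sgn)
  with assms have "\<exists>U G. open U \<and> sgn x \<in> U \<and> C1_on G U \<and> (\<forall>z\<in>U \<inter> unit_sphere. G z = g z)"
    unfolding C1_on_sphere_def by (rule bspec)
  then obtain U G where U: "open U" "sgn x \<in> U" and G: "C1_on G U"
    and eq: "\<forall>z\<in>U \<inter> unit_sphere. G z = g z"
    by (elim exE conjE)
  define T where "T = - {0} \<inter> sgn -` U"
  have "open T"
    unfolding T_def using \<open>open U\<close>
    by (intro continuous_open_preimage continuous_on_sgn continuous_intros) auto
  moreover have "x \<in> T"
    using U \<open>x \<in> - {0}\<close> by (simp add: T_def)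
  moreover have "C1_on (\<lambda>x. g (sgn x)) T"
  proof (rule C1_on_cong)
    have "C1_on sgn T"
      by (rule C1_on_subset[OF C1_on_sgn]) (simp add: T_def)
    then show "C1_on (\<lambda>x. G (sgn x)) T"
      by (rule C1_on_compose[OF G]) (auto simp: T_def)
    show "G (sgn z) = g (sgn z)" if "z \<in> T" for z
      using that by (intro eq[rule_format]) (auto simp: T_def norm_sgn)
  qed fact
  ultimately show "\<exists>T. open T \<and> x \<in> T \<and> C1_on (\<lambda>x. g (sgn x)) T"
    by blast
qed

text \<open>Differentiate the trivial identity \<open>g (sgn (sgn z)) = g (sgn z)\<close> by the
  chain rule.\<close>

lemma frechet_derivative_radial_extension_proj:
  fixes g :: "'a::euclidean_space \<Rightarrow> 'b::real_normed_vector"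
  assumes C1: "C1_on (\<lambda>x. g (sgn x)) (- {0})" and "x \<noteq> 0"
  shows "frechet_derivative (\<lambda>z. g (sgn z)) (at x) \<xi> =
    frechet_derivative (\<lambda>z. g (sgn z)) (at (sgn x)) (tangent_proj (sgn x) \<xi>) /\<^sub>R norm x"
proof -
  define D where "D = frechet_derivative (\<lambda>z. g (sgn z)) (at (sgn x))"
  have D: "((\<lambda>z. g (sgn z)) has_derivative D) (at (sgn x))"
    unfolding D_def by (rule C1_on_has_derivative[OF C1]) (use \<open>x \<noteq> 0\<close> in \<open>simp add: sgn_zero_iff\<close>)
  have "((\<lambda>z. g (sgn (sgn z))) has_derivative (\<lambda>\<xi>. D (tangent_proj (sgn x) \<xi> /\<^sub>R norm x))) (at x)"
    by (rule has_derivative_compose[OF has_derivative_sgn[OF \<open>x \<noteq> 0\<close>] D])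
  moreover have "linear D"
    using D has_derivative_linear by blast
  ultimately have "((\<lambda>z. g (sgn z)) has_derivative (\<lambda>\<xi>. D (tangent_proj (sgn x) \<xi>) /\<^sub>R norm x)) (at x)"
    by (simp add: linear_scale)
  from frechet_derivative_at[OF this, symmetric] show ?thesis
    by (simp add: D_def)
qed

text \<open>At a point of unit norm the preceding formula says that the derivative does not see the
  radial part of a vector. Fed back into that formula, this removes the projection and leaves
  homogeneity of degree minus one.\<close>

lemma frechet_derivative_radial_extension:
  fixes g :: "'a::euclidean_space \<Rightarrow> 'b::real_normed_vector"
  assumes C1: "C1_on (\<lambda>x. g (sgn x)) (- {0})" and "x \<noteq> 0"
  shows "frechet_derivative (\<lambda>z. g (sgn z)) (at x) \<xi> =
      frechet_derivative (\<lambda>z. g (sgn z)) (at (sgn x)) \<xi> /\<^sub>R norm x"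
    and "frechet_derivative (\<lambda>z. g (sgn z)) (at (sgn x)) (tangent_proj (sgn x) \<xi>) =
      frechet_derivative (\<lambda>z. g (sgn z)) (at (sgn x)) \<xi>"
    and "frechet_derivative (\<lambda>z. g (sgn z)) (at (sgn x)) (sgn x) = 0"
proof -
  let ?D = "frechet_derivative (\<lambda>z. g (sgn z)) (at (sgn x))"
  have y: "sgn x \<noteq> 0" "norm (sgn x) = 1"
    using \<open>x \<noteq> 0\<close> by (simp_all add: sgn_zero_iff norm_sgn)
  have proj: "?D (tangent_proj (sgn x) \<xi>) = ?D \<xi>" for \<xi>
    using frechet_derivative_radial_extension_proj[OF C1 y(1), of \<xi>] y by simp
  show "?D (tangent_proj (sgn x) \<xi>) = ?D \<xi>"
    by (rule proj)
  show "frechet_derivative (\<lambda>z. g (sgn z)) (at x) \<xi> = ?D \<xi> /\<^sub>R norm x"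
    using frechet_derivative_radial_extension_proj[OF assms] proj by simp
  have "linear ?D"
    by (rule has_derivative_linear[OF C1_on_has_derivative[OF C1]]) (use y in simp)
  moreover have "tangent_proj (sgn x) (sgn x) = 0"
    using y by (simp add: tangent_proj_def power2_norm_eq_inner[symmetric])
  ultimately show "?D (sgn x) = 0"
    using proj[of "sgn x"] by (simp add: linear_0)
qed

lemma tangential_inner:
  assumes "tangential v"
  shows "v (sgn x) \<bullet> x = 0"
proof (cases "x = 0")
  case False
  then have "v (sgn x) \<bullet> sgn x = 0"
    using assms by (simp add: tangential_def sphere_tangent_def norm_sgn)
  then show ?thesis
    using False by (simp add: sgn_div_norm)
qed simp

text \<open>Differentiate the tangency relation \<open>v (sgn z) \<bullet> z = 0\<close>. At unit
  norm this is the second fundamental form of the sphere; for \<open>\<xi> = v y\<close> it produces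
  the term \<open>- (norm (v y))\<^sup>2\<close> on which both directions of the theorem
  depend.\<close>

lemma tangential_frechet_derivative:
  fixes v :: "'a::euclidean_space \<Rightarrow> 'a"
  assumes C1: "C1_on (\<lambda>x. v (sgn x)) (- {0})" and "tangential v" and "x \<noteq> 0"
  shows "frechet_derivative (\<lambda>z. v (sgn z)) (at x) \<xi> \<bullet> x = - (v (sgn x) \<bullet> \<xi>)"
proof -
  have "((\<lambda>z. v (sgn z) \<bullet> z) has_derivative
      (\<lambda>\<xi>. v (sgn x) \<bullet> \<xi> + frechet_derivative (\<lambda>z. v (sgn z)) (at x) \<xi> \<bullet> x)) (at x)"
    by (rule has_derivative_inner[OF C1_on_has_derivative[OF C1] has_derivative_ident])
      (use \<open>x \<noteq> 0\<close> in simp)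
  moreover have "((\<lambda>z. v (sgn z) \<bullet> z) has_derivative (\<lambda>_. 0)) (at x)"
    by (simp add: tangential_inner[OF \<open>tangential v\<close>])
  ultimately have "(\<lambda>\<xi>. v (sgn x) \<bullet> \<xi> + frechet_derivative (\<lambda>z. v (sgn z)) (at x) \<xi> \<bullet> x) = (\<lambda>_. 0)"
    by (rule has_derivative_unique)
  then show ?thesis
    by (simp add: fun_eq_iff eq_neg_iff_add_eq_0 add.commute)
qed

text \<open>This is the trace of the rank-one map sending \<open>\<xi>\<close> to
  \<open>(L \<xi> \<bullet> z) *\<^sub>R y\<close>.\<close>

lemma linear_trace_inner:
  fixes L :: "'a::euclidean_space \<Rightarrow> 'b::real_inner"
  assumes "linear L"
  shows "(\<Sum>b\<in>Basis. (L b \<bullet> z) * (y \<bullet> b)) = L y \<bullet> z"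
proof -
  have "L y = L (\<Sum>b\<in>Basis. (y \<bullet> b) *\<^sub>R b)"
    by (simp only: euclidean_representation)
  also have "\<dots> = (\<Sum>b\<in>Basis. (y \<bullet> b) *\<^sub>R L b)"
    using assms by (simp add: linear_sum linear_scale)
  finally show ?thesis
    by (simp add: inner_sum_left mult.commute)
qed

section \<open>Sphere operators in terms of the radial extension\<close>

text \<open>Projecting the argument changes nothing because \<open>D y = 0\<close>; projecting the
  value changes the trace by \<open>D y \<bullet> y\<close>, which vanishes for the same
  reason.\<close>

lemma sphere_divergence_eq:
  fixes v :: "'a::euclidean_space \<Rightarrow> 'a"
  assumes C1: "C1_on (\<lambda>x. v (sgn x)) (- {0})" and y: "y \<in> unit_sphere"
  shows "sphere_divergence v y = divergence (\<lambda>x. v (sgn x)) y"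
proof -
  define D where "D = frechet_derivative (\<lambda>x. v (sgn x)) (at y)"
  have "y \<noteq> 0" and [simp]: "sgn y = y"
    using y by (auto simp: sgn_div_norm)
  have "linear D"
    unfolding D_def
    by (rule has_derivative_linear[OF C1_on_has_derivative[OF C1]]) (use \<open>y \<noteq> 0\<close> in simp)
  have D: "D (tangent_proj y \<xi>) = D \<xi>" "D y = 0" for \<xi>
    unfolding D_def using frechet_derivative_radial_extension[OF C1 \<open>y \<noteq> 0\<close>] by simp_all
  have "sphere_divergence v y = (\<Sum>b\<in>Basis. D b \<bullet> b - (D b \<bullet> y) * (y \<bullet> b))"
    unfolding sphere_divergence_def sphere_cov_deriv_def D_def[symmetric] D
    by (simp add: tangent_proj_def inner_diff_left)
  also have "\<dots> = divergence (\<lambda>x. v (sgn x)) y"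
    unfolding sum_subtractf linear_trace_inner[OF \<open>linear D\<close>]
    by (simp add: D) (simp add: divergence_def D_def)
  finally show ?thesis .
qed

text \<open>The pullback of \<open>flat v\<close> is \<open>flat (v \<circ> sgn)\<close> weighted by
  \<open>inverse (norm x)\<close>. On the sphere the weight is 1 and its tangential derivatives
  vanish, so it does not contribute.\<close>

lemma sphere_ext_d_flat_eq:
  fixes v :: "'a::euclidean_space \<Rightarrow> 'a"
  assumes C1: "C1_on (\<lambda>x. v (sgn x)) (- {0})" and tang: "tangential v" and y: "y \<in> unit_sphere"
    and "\<xi> \<in> sphere_tangent y" "\<eta> \<in> sphere_tangent y"
  shows "sphere_ext_d (flat v) y \<xi> \<eta> =
    frechet_derivative (\<lambda>x. v (sgn x)) (at y) \<xi> \<bullet> \<eta> - frechet_derivative (\<lambda>x. v (sgn x)) (at y) \<eta> \<bullet> \<xi>"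
proof -
  define D where "D = frechet_derivative (\<lambda>x. v (sgn x)) (at y)"
  have "y \<noteq> 0" and [simp]: "sgn y = y" "norm y = 1"
    using y by (auto simp: sgn_div_norm)
  have D: "((\<lambda>x. v (sgn x)) has_derivative D) (at y)"
    unfolding D_def by (rule C1_on_has_derivative[OF C1]) (use \<open>y \<noteq> 0\<close> in simp)
  have pb: "pullback sgn (flat v) x \<zeta> = inverse (norm x) * (v (sgn x) \<bullet> \<zeta>)" if "x \<noteq> 0" for x \<zeta>
  proof -
    have "frechet_derivative sgn (at x) \<zeta> = tangent_proj (sgn x) \<zeta> /\<^sub>R norm x"
      by (simp add: frechet_derivative_at[OF has_derivative_sgn[OF that], symmetric])
    moreover have "v (sgn x) \<bullet> sgn x = 0"
      using tangential_inner[OF tang, of x] by (simp add: sgn_div_norm)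
    ultimately show ?thesis
      by (simp add: pullback_def flat_def tangent_proj_def inner_diff_right)
  qed
  have pb': "frechet_derivative (\<lambda>x. pullback sgn (flat v) x \<zeta>) (at y) \<zeta>' = D \<zeta>' \<bullet> \<zeta>"
    if "\<zeta>' \<in> sphere_tangent y" for \<zeta> \<zeta>'
  proof -
    have "((\<lambda>x. inverse (norm x) * (v (sgn x) \<bullet> \<zeta>)) has_derivative
        (\<lambda>\<xi>. D \<xi> \<bullet> \<zeta> - (\<xi> \<bullet> y) * (v y \<bullet> \<zeta>))) (at y)"
      using \<open>y \<noteq> 0\<close> by (auto intro!: derivative_eq_intros has_derivative_norm D simp: inner_commute)
    then have "((\<lambda>x. pullback sgn (flat v) x \<zeta>) has_derivative
        (\<lambda>\<xi>. D \<xi> \<bullet> \<zeta> - (\<xi> \<bullet> y) * (v y \<bullet> \<zeta>))) (at y)"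
      by (rule has_derivative_transform_within_open[where s = "- {0}"])
        (use \<open>y \<noteq> 0\<close> in \<open>auto simp: pb\<close>)
    from frechet_derivative_at[OF this, symmetric] show ?thesis
      using that by (simp add: sphere_tangent_def)
  qed
  show ?thesis
    using assms(4,5) unfolding sphere_ext_d_def ext_d_def D_def[symmetric] by (simp add: pb')
qed

lemma divergence_radial_extension:
  fixes v :: "'a::euclidean_space \<Rightarrow> 'a"
  assumes C1: "C1_on (\<lambda>x. v (sgn x)) (- {0})" and "sphere_geodesible v" and "x \<noteq> 0"
  shows "divergence (\<lambda>x. v (sgn x)) x = 0"
proof -
  have y: "sgn x \<in> unit_sphere"
    using \<open>x \<noteq> 0\<close> by (simp add: norm_sgn)
  have "divergence (\<lambda>x. v (sgn x)) x = divergence (\<lambda>x. v (sgn x)) (sgn x) / norm x"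
    unfolding divergence_def frechet_derivative_radial_extension(1)[OF C1 \<open>x \<noteq> 0\<close>]
    by (simp add: sum_distrib_left divide_inverse mult.commute)
  also have "divergence (\<lambda>x. v (sgn x)) (sgn x) = sphere_divergence v (sgn x)"
    by (rule sphere_divergence_eq[OF C1 y, symmetric])
  also have "\<dots> = 0"
    using \<open>sphere_geodesible v\<close> y by (simp add: sphere_geodesible_def)
  finally show ?thesis by simp
qed

text \<open>The extension of a geodesible field by radial constancy fails to be geodesible in the
  ambient space only through a radial term: the sphere condition handles the tangential part of
  \<open>\<eta>\<close>, and tangency of \<open>v\<close> gives the normal part. The powers of
  \<open>norm x\<close> come from scaling.\<close>

lemma geodesible_radial_extension:
  fixes v :: "'a::euclidean_space \<Rightarrow> 'a"
  assumes C1: "C1_on (\<lambda>x. v (sgn x)) (- {0})" and tang: "tangential v"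
    and geo: "sphere_geodesible v" and "x \<noteq> 0"
  defines "D \<equiv> frechet_derivative (\<lambda>z. v (sgn z)) (at x)"
  shows "D (v (sgn x)) \<bullet> \<eta> - D \<eta> \<bullet> v (sgn x) = - ((x \<bullet> \<eta>) * (norm (v (sgn x)))\<^sup>2 / (norm x)\<^sup>2)"
proof -
  define y where "y = sgn x"
  define Dy where "Dy = frechet_derivative (\<lambda>z. v (sgn z)) (at y)"
  have y: "y \<in> unit_sphere" "y \<noteq> 0" "norm y = 1" "sgn y = y"
    using \<open>x \<noteq> 0\<close> by (simp_all add: y_def norm_sgn sgn_zero_iff)
  have x: "x = norm x *\<^sub>R y"
    using \<open>x \<noteq> 0\<close> by (simp add: y_def sgn_div_norm)
  have yy: "y \<bullet> y = 1"
    using y by (simp add: power2_norm_eq_inner[symmetric])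
  have D: "D \<xi> = Dy \<xi> /\<^sub>R norm x" for \<xi>
    unfolding D_def Dy_def y_def by (rule frechet_derivative_radial_extension[OF C1 \<open>x \<noteq> 0\<close>])
  have vy: "v y \<in> sphere_tangent y"
    using tang y by (simp add: tangential_def)
  have Dy_proj: "Dy (tangent_proj y \<eta>) = Dy \<eta>"
    unfolding Dy_def y_def by (rule frechet_derivative_radial_extension[OF C1 \<open>x \<noteq> 0\<close>])
  have "tangent_proj y \<eta> \<in> sphere_tangent y"
    by (simp add: tangent_proj_def sphere_tangent_def inner_diff_left yy)
  then have "sphere_ext_d (flat v) y (v y) (tangent_proj y \<eta>) = 0"
    using geo y unfolding sphere_geodesible_def contraction_def by blast
  then have "Dy (v y) \<bullet> tangent_proj y \<eta> = Dy \<eta> \<bullet> v y"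
    using sphere_ext_d_flat_eq[OF C1 tang y(1) vy \<open>tangent_proj y \<eta> \<in> sphere_tangent y\<close>]
    by (simp add: Dy_def[symmetric] Dy_proj)
  moreover have "Dy (v y) \<bullet> y = - (norm (v y))\<^sup>2"
    using tangential_frechet_derivative[OF C1 tang y(2), of "v y"] y(4)
    by (simp add: Dy_def power2_norm_eq_inner)
  ultimately have "Dy (v y) \<bullet> \<eta> - Dy \<eta> \<bullet> v y = - ((y \<bullet> \<eta>) * (norm (v y))\<^sup>2)"
    by (simp add: tangent_proj_def inner_diff_right inner_commute)
  then have "inverse (norm x) * (Dy (v y) \<bullet> \<eta> - Dy \<eta> \<bullet> v y) = inverse (norm x) * - ((y \<bullet> \<eta>) * (norm (v y))\<^sup>2)"
    by (rule arg_cong)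
  moreover have "y \<bullet> \<eta> = (x \<bullet> \<eta>) / norm x"
    by (simp add: y_def sgn_div_norm divide_inverse mult.commute)
  ultimately show ?thesis
    using \<open>x \<noteq> 0\<close>
    by (simp add: D y_def[symmetric] right_diff_distrib field_simps power2_eq_square)
qed

section \<open>The homogeneous solution of degree minus one\<close>

lemma C1_on_sphere_minus_half_norm_sq:
  fixes v :: "'a::euclidean_space \<Rightarrow> 'b::euclidean_space"
  assumes "C1_on_sphere v"
  shows "C1_on_sphere (\<lambda>y. - (1/2) * (norm (v y))\<^sup>2)"
  unfolding C1_on_sphere_def
proof
  fix y :: 'a assume "y \<in> unit_sphere"
  with assms have "\<exists>U G. open U \<and> y \<in> U \<and> C1_on G U \<and> (\<forall>x\<in>U \<inter> unit_sphere. G x = v x)"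
    unfolding C1_on_sphere_def by (rule bspec)
  then obtain U G where UG: "open U" "y \<in> U" "C1_on G U" "\<forall>x\<in>U \<inter> unit_sphere. G x = v x"
    by (elim exE conjE)
  \<comment> \<open>The inner product avoids differentiating the norm at zeros of the field.\<close>
  have "C1_on (\<lambda>x. - (1/2) * (G x \<bullet> G x)) U"
    by (intro C1_on_mult C1_on_inner C1_on_const UG)
  with UG show "\<exists>U H. open U \<and> y \<in> U \<and> C1_on H U \<and>
      (\<forall>x\<in>U \<inter> unit_sphere. H x = - (1/2) * (norm (v x))\<^sup>2)"
    by (intro exI[of _ U] exI[of _ "\<lambda>x. - (1/2) * (G x \<bullet> G x)"]) (auto simp: power2_norm_eq_inner)
qed

text \<open>The gradient of the weight \<open>1 / norm x\<close> is radial. It therefore leaves the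
  divergence zero, and its contribution to the contraction cancels exactly the radial defect found
  in \<open>geodesible_radial_extension\<close>. The pressure makes the Bernoulli function vanish,
  so the Euler equation reduces to geodesibility.\<close>

lemma geodesible_euler_degree_minus_one:
  fixes v :: "'a::euclidean_space \<Rightarrow> 'a"
  assumes C1v: "C1_on_sphere v" and tang: "tangential v" and geo: "sphere_geodesible v"
  defines "u \<equiv> \<lambda>x. (1 / norm x) *\<^sub>R v (sgn x)"
    and "p \<equiv> \<lambda>x. (1 / norm x powr 2) * (- (1/2) * (norm (v (sgn x)))\<^sup>2)"
  shows "steady_euler_on (- {0}) u p" and "geodesible_on (- {0}) u"
proof -
  let ?V = "\<lambda>x. v (sgn x)"
  note C1 = C1_on_radial_extension[OF C1v]
  have C1u: "C1_on u (- {0})"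
  proof (rule C1_on_cong)
    show "C1_on (\<lambda>x. norm x powr (- 1) *\<^sub>R ?V x) (- {0})"
      by (intro C1_on_scaleR C1_on_norm_powr C1)
  qed (simp_all add: u_def powr_minus_divide open_Compl)
  have C1p: "C1_on p (- {0})"
  proof (rule C1_on_cong)
    show "C1_on (\<lambda>x. norm x powr (- 2) * (- (1/2) * (norm (?V x))\<^sup>2)) (- {0})"
      by (intro C1_on_mult C1_on_norm_powr C1_on_radial_extension[OF C1_on_sphere_minus_half_norm_sq[OF C1v]])
  qed (simp_all add: p_def powr_minus_divide open_Compl)
  have du: "frechet_derivative u (at x) \<xi> =
      (1 / norm x) *\<^sub>R frechet_derivative ?V (at x) \<xi> - ((x \<bullet> \<xi>) / norm x ^ 3) *\<^sub>R ?V x"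
    if "x \<noteq> 0" for x \<xi>
  proof -
    have "((\<lambda>z. 1 / norm z) has_derivative (\<lambda>\<xi>. - ((x \<bullet> \<xi>) / norm x ^ 3))) (at x)"
      using that by (auto intro!: derivative_eq_intros has_derivative_norm
        simp: sgn_div_norm inner_commute power3_eq_cube divide_simps)
    moreover have "(?V has_derivative frechet_derivative ?V (at x)) (at x)"
      by (rule C1_on_has_derivative[OF C1]) (use that in simp)
    ultimately have "(u has_derivative (\<lambda>\<xi>. (1 / norm x) *\<^sub>R frechet_derivative ?V (at x) \<xi> +
        (- ((x \<bullet> \<xi>) / norm x ^ 3)) *\<^sub>R ?V x)) (at x)"
      unfolding u_def by (rule has_derivative_scaleR)
    from frechet_derivative_at[OF this, symmetric] show ?thesis by simp
  qed
  have Vx: "?V x \<bullet> x = 0" "x \<bullet> ?V x = 0" for x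
    using tangential_inner[OF tang, of x] by (simp_all add: inner_commute)
  have div: "divergence u x = 0" if "x \<noteq> 0" for x
  proof -
    have "divergence u x = divergence ?V x / norm x - (x \<bullet> ?V x) / norm x ^ 3"
      by (simp add: divergence_def du[OF that] inner_diff_left sum_subtractf
        sum_divide_distrib euclidean_inner[of x "?V x"])
    then show ?thesis
      by (simp add: Vx divergence_radial_extension[OF C1 geo that])
  qed
  have contr: "contraction u (ext_d (flat u)) x \<eta> = 0" if "x \<noteq> 0" for x \<eta>
  proof -
    let ?D = "frechet_derivative ?V (at x)"
    have "linear ?D"
      by (rule has_derivative_linear[OF C1_on_has_derivative[OF C1]]) (use that in simp)
    have "u differentiable at x"
      using C1_on_differentiable[OF C1u] that by simp
    then have "contraction u (ext_d (flat u)) x \<eta> =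
        frechet_derivative u (at x) (u x) \<bullet> \<eta> - frechet_derivative u (at x) \<eta> \<bullet> u x"
      by (simp add: contraction_def ext_d_def flat_def frechet_derivative_inner_left)
    \<comment> \<open>The second summand comes from differentiating the weight along
      \<open>\<eta>\<close>; differentiating it along \<open>u\<close> gives nothing, as
      \<open>u\<close> is tangential.\<close>
    also have "\<dots> = (?D (?V x) \<bullet> \<eta> - ?D \<eta> \<bullet> ?V x) / norm x ^ 2
        + ((x \<bullet> \<eta>) * (norm (?V x))\<^sup>2 / (norm x)\<^sup>2) / norm x ^ 2"
      unfolding du[OF that] using \<open>linear ?D\<close> that
      by (simp add: u_def linear_scale inner_diff_left Vx dot_square_norm divide_simps power2_eq_square power3_eq_cube)
        (simp add: algebra_simps)
    also have "\<dots> = 0"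
      unfolding geodesible_radial_extension[OF C1 tang geo that] by simp
    finally show ?thesis .
  qed
  have "bernoulli u p = (\<lambda>_. 0)"
  proof
    show "bernoulli u p x = 0" for x
      \<comment> \<open>At the origin division by zero yields 0 for both \<open>u\<close> and
        \<open>p\<close>, so the function is constant on the whole space.\<close>
      by (cases "x = 0") (simp_all add: bernoulli_def u_def p_def power_divide)
  qed
  then have "differential (bernoulli u p) x = (\<lambda>_. 0)" for x
    by (simp add: differential_def)
  then show "steady_euler_on (- {0}) u p"
    using C1u C1p div contr by (simp add: steady_euler_on_def)
  show "geodesible_on (- {0}) u"
    using div contr by (simp add: geodesible_on_def)
qed

section \<open>Uniqueness of the degree\<close>

text \<open>At the unit point \<open>y\<close> the contraction is tested on \<open>y\<close> itself.
  There \<open>L y = - \<alpha> *\<^sub>R u y\<close>, the terms quadratic in \<open>f\<close>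
  cancel, and \<open>Df (v y) - (1 - \<alpha>) * (v y \<bullet> v y)\<close> remains. Homogeneity of
  the derivative of the extension carries the identity to \<open>x\<close>.\<close>

lemma geodesible_radial_component:
  fixes v :: "'a::euclidean_space \<Rightarrow> 'a" and f :: "'a \<Rightarrow> real" and \<alpha> :: real
  assumes C1: "C1_on (\<lambda>x. v (sgn x)) (- {0})" and C1f: "C1_on (\<lambda>x. f (sgn x)) (- {0})"
    and tang: "tangential v" and "x \<noteq> 0"
  defines "u \<equiv> \<lambda>x. (1 / norm x powr \<alpha>) *\<^sub>R (v (sgn x) + f (sgn x) *\<^sub>R sgn x)"
  assumes geo: "geodesible_on (- {0}) u"
  shows "frechet_derivative (\<lambda>x. f (sgn x)) (at x) (v (sgn x)) = (1 - \<alpha>) * (norm (v (sgn x)))\<^sup>2 / norm x"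
proof -
  define y where "y = sgn x"
  define D where "D = frechet_derivative (\<lambda>z. v (sgn z)) (at y)"
  define Df where "Df = frechet_derivative (\<lambda>z. f (sgn z)) (at y)"
  have y: "y \<in> unit_sphere" "y \<noteq> 0" "norm y = 1" "sgn y = y"
    using \<open>x \<noteq> 0\<close> by (simp_all add: y_def norm_sgn sgn_zero_iff)
  have yy: "y \<bullet> y = 1"
    using y by (simp add: power2_norm_eq_inner[symmetric])
  have vy: "v y \<bullet> y = 0" "y \<bullet> v y = 0"
    using tangential_inner[OF tang, of y] y by (simp_all add: inner_commute)
  have D: "((\<lambda>z. v (sgn z)) has_derivative D) (at y)" and Df: "((\<lambda>z. f (sgn z)) has_derivative Df) (at y)"
    unfolding D_def Df_def using y by (auto intro!: C1_on_has_derivative[OF C1] C1_on_has_derivative[OF C1f])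
  have lin: "linear D" "linear Df"
    using D Df has_derivative_linear by blast+
  have rad: "D y = 0" "Df y = 0"
    unfolding D_def Df_def y_def
    by (rule frechet_derivative_radial_extension[OF C1 \<open>x \<noteq> 0\<close>] frechet_derivative_radial_extension[OF C1f \<open>x \<noteq> 0\<close>])+
  have uy: "u y = v y + f y *\<^sub>R y"
    by (simp add: u_def y)
  \<comment> \<open>The first term differentiates the weight
    \<open>norm z powr (- \<alpha>)\<close>, which equals 1 at \<open>y\<close>; the rest
    differentiates the bracket.\<close>
  define L where "L \<xi> = (- \<alpha> * (\<xi> \<bullet> y)) *\<^sub>R u y + (D \<xi> + (Df \<xi> *\<^sub>R y + f y *\<^sub>R tangent_proj y \<xi>))" for \<xi>
  have L: "(u has_derivative L) (at y)"
  proof -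
    have "((\<lambda>z. norm z powr (- \<alpha>)) has_derivative (\<lambda>\<xi>. - \<alpha> * (\<xi> \<bullet> y))) (at y)"
      using y by (auto intro!: derivative_eq_intros has_derivative_norm)
    moreover have "((\<lambda>z. sgn z) has_derivative tangent_proj y) (at y)"
      using has_derivative_sgn[OF y(2)] y by simp
    then have "((\<lambda>z. v (sgn z) + f (sgn z) *\<^sub>R sgn z) has_derivative
        (\<lambda>\<xi>. D \<xi> + (f (sgn y) *\<^sub>R tangent_proj y \<xi> + Df \<xi> *\<^sub>R sgn y))) (at y)"
      by (intro has_derivative_add has_derivative_scaleR D Df)
    ultimately have "((\<lambda>z. norm z powr (- \<alpha>) *\<^sub>R (v (sgn z) + f (sgn z) *\<^sub>R sgn z)) has_derivative
        (\<lambda>\<xi>. norm y powr (- \<alpha>) *\<^sub>R (D \<xi> + (f (sgn y) *\<^sub>R tangent_proj y \<xi> + Df \<xi> *\<^sub>R sgn y)) +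
          (- \<alpha> * (\<xi> \<bullet> y)) *\<^sub>R (v (sgn y) + f (sgn y) *\<^sub>R sgn y))) (at y)"
      by (rule has_derivative_scaleR)
    moreover have "(\<lambda>\<xi>. norm y powr (- \<alpha>) *\<^sub>R (D \<xi> + (f (sgn y) *\<^sub>R tangent_proj y \<xi> + Df \<xi> *\<^sub>R sgn y)) +
          (- \<alpha> * (\<xi> \<bullet> y)) *\<^sub>R (v (sgn y) + f (sgn y) *\<^sub>R sgn y)) = L"
      by (simp add: L_def[abs_def] uy y add_ac)
    ultimately have "((\<lambda>z. norm z powr (- \<alpha>) *\<^sub>R (v (sgn z) + f (sgn z) *\<^sub>R sgn z)) has_derivative L) (at y)"
      by simp
    then show ?thesis
      by (simp add: u_def powr_minus_divide)
  qed
  have "contraction u (ext_d (flat u)) y y = 0"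
    using geo y by (simp add: geodesible_on_def)
  moreover have "u differentiable at y"
    using L by (auto simp: differentiable_def)
  ultimately have "L (u y) \<bullet> y - L y \<bullet> u y = 0"
    using frechet_derivative_at[OF L, symmetric]
    by (simp add: contraction_def ext_d_def flat_def frechet_derivative_inner_left)
  moreover have "D (v y) \<bullet> y = - (v y \<bullet> v y)"
    using tangential_frechet_derivative[OF C1 tang y(2), of "v y"] y by (simp add: D_def)
  ultimately have "Df (v y) = (1 - \<alpha>) * (v y \<bullet> v y)"
    using lin
    by (simp add: L_def uy linear_add linear_scale rad tangent_proj_def inner_add_left inner_add_right
      inner_diff_left vy yy algebra_simps)
  then show ?thesis
    using frechet_derivative_radial_extension(1)[OF C1f \<open>x \<noteq> 0\<close>]
    by (simp add: Df_def y_def power2_norm_eq_inner divide_inverse mult.commute)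
qed

section \<open>Radial cutoff and integration\<close>

lemma divergence_scaleR:
  fixes w :: "'a::euclidean_space \<Rightarrow> 'a"
  assumes h: "(h has_derivative h') (at x)" and w: "w differentiable at x"
  shows "divergence (\<lambda>z. h z *\<^sub>R w z) x = h' (w x) + h x * divergence w x"
proof -
  have "((\<lambda>z. h z *\<^sub>R w z) has_derivative
      (\<lambda>\<xi>. h x *\<^sub>R frechet_derivative w (at x) \<xi> + h' \<xi> *\<^sub>R w x)) (at x)"
    by (rule has_derivative_scaleR[OF h has_derivative_frechet[OF w]])
  note D = frechet_derivative_at[OF this, symmetric]
  have "linear h'"
    using h has_derivative_linear by blast
  \<comment> \<open>For the scalar map \<open>h'\<close>, the inner product with 1 is
    \<open>h'\<close> itself, so the trace of the rank-one part is \<open>h' (w x)\<close>.\<close>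
  from linear_trace_inner[OF this, of 1 "w x"] show ?thesis
    by (simp add: divergence_def D inner_add_left sum.distrib sum_distrib_left)
qed

text \<open>Squaring the positive part smooths its corner at 0; this truncates a polynomial to a
  continuously differentiable cutoff.\<close>

lemma C1_on_max_sq: "C1_on (\<lambda>t :: real. (max 0 t)\<^sup>2) UNIV"
proof (rule C1_onI)
  show "((\<lambda>t :: real. (max 0 t)\<^sup>2) has_derivative (\<lambda>s. s * (2 * max 0 t))) (at t)" for t
  proof (cases t "0 :: real" rule: linorder_cases)
    case less
    have "((\<lambda>_. 0) has_derivative (\<lambda>s. s * (2 * max 0 t))) (at t)"
      using less by simp
    then show ?thesis
      by (rule has_derivative_transform_within_open[of _ _ _ _ "{..<0}"]) (use less in auto)
  next
    case greater
    have "((\<lambda>t. t\<^sup>2) has_derivative (\<lambda>s. s * (2 * max 0 t))) (at t)"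
      using greater by (auto intro!: derivative_eq_intros)
    then show ?thesis
      by (rule has_derivative_transform_within_open[of _ _ _ _ "{0<..}"]) (use greater in auto)
  next
    case equal
    have "((\<lambda>h :: real. max 0 h) \<longlongrightarrow> 0) (at 0)"
      by (auto intro!: tendsto_eq_intros)
    \<comment> \<open>The difference quotient at 0 equals \<open>max 0 h\<close> for
      \<open>h \<noteq> 0\<close>.\<close>
    then have "((\<lambda>h :: real. ((max 0 (0 + h))\<^sup>2 - (max 0 0)\<^sup>2) / h) \<longlongrightarrow> 0) (at 0)"
      by (rule Lim_transform_eventually)
        (auto simp: eventually_at_filter power2_eq_square max_def divide_simps)
    then have "((\<lambda>t :: real. (max 0 t)\<^sup>2) has_real_derivative 0) (at 0)"
      by (simp only: DERIV_def)
    then show ?thesis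
      using equal by (simp add: has_field_derivative_def mult_zero_left[abs_def])
  qed
  show "continuous_on UNIV (\<lambda>t. b * (2 * max 0 t))" for b :: real
    by (intro continuous_intros)
qed

text \<open>In the divergence of \<open>W\<close> the cutoff is not differentiated, being radial
  while \<open>v\<close> is tangential, and \<open>v\<close> is divergence-free; what is left is
  \<open>\<phi>\<close> times the derivative of \<open>f\<close> along \<open>v\<close>, that is
  \<open>(1 - \<alpha>) * g\<close>. For \<open>\<alpha> \<noteq> 1\<close> the integral of
  \<open>g \<ge> 0\<close> would be zero although \<open>g\<close> is positive somewhere.\<close>

lemma geodesible_degree_unique:
  fixes v :: "'a::euclidean_space \<Rightarrow> 'a" and f :: "'a \<Rightarrow> real" and \<alpha> :: real
  assumes C1: "C1_on (\<lambda>x. v (sgn x)) (- {0})" and C1f: "C1_on (\<lambda>x. f (sgn x)) (- {0})"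
    and tang: "tangential v" and geo: "sphere_geodesible v"
    and y: "y \<in> unit_sphere" "v y \<noteq> 0"
    and u: "geodesible_on (- {0}) (\<lambda>x. (1 / norm x powr \<alpha>) *\<^sub>R (v (sgn x) + f (sgn x) *\<^sub>R sgn x))"
  shows "\<alpha> = 1"
proof (rule ccontr)
  assume "\<alpha> \<noteq> 1"
  let ?V = "\<lambda>x. v (sgn x)" and ?F = "\<lambda>x. f (sgn x)"
  \<comment> \<open>\<open>P\<close> is positive exactly on the shell \<open>1 < norm x < 2\<close>;
    as a polynomial in \<open>x \<bullet> x\<close> it is smooth at the origin too.\<close>
  define P where "P x = (x \<bullet> x - 1) * (4 - x \<bullet> x)" for x :: 'a
  define \<phi> where "\<phi> x = (max 0 (P x))\<^sup>2" for x
  define W where "W x = (\<phi> x * ?F x) *\<^sub>R ?V x" for x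
  define g where "g x = \<phi> x * ((norm (?V x))\<^sup>2 / norm x)" for x
  have DP: "(P has_derivative (\<lambda>\<xi>. (5 - 2 * (x \<bullet> x)) * (2 * (x \<bullet> \<xi>)))) (at x)" for x
    unfolding P_def by (auto intro!: derivative_eq_intros simp: inner_commute algebra_simps)
  have C1P: "C1_on P UNIV"
  proof (rule C1_onI[OF DP])
    show "continuous_on UNIV (\<lambda>x. (5 - 2 * (x \<bullet> x)) * (2 * (x \<bullet> b)))" for b :: 'a
      by (intro continuous_intros)
  qed
  have C1\<phi>: "C1_on \<phi> UNIV"
    unfolding \<phi>_def[abs_def] by (rule C1_on_compose[OF C1_on_max_sq C1P]) simp
  have \<phi>0: "\<phi> x = 0" if "norm x \<le> 1 \<or> 2 \<le> norm x" for x
  proof -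
    have "x \<bullet> x \<le> 1 \<or> 4 \<le> x \<bullet> x"
      using that power_mono[of "norm x" 1 2] power_mono[of 2 "norm x" 2]
      by (auto simp: power2_norm_eq_inner)
    then have "P x \<le> 0"
      by (auto simp: P_def mult_le_0_iff)
    then show ?thesis
      by (simp add: \<phi>_def)
  qed
  have D\<phi>: "frechet_derivative \<phi> (at x) (?V x) = 0" for x
  proof -
    have D: "((\<lambda>t. (max 0 t)\<^sup>2) has_derivative frechet_derivative (\<lambda>t. (max 0 t)\<^sup>2) (at (P x))) (at (P x))"
      by (rule C1_on_has_derivative[OF C1_on_max_sq]) simp
    have "linear (frechet_derivative (\<lambda>t. (max 0 t)\<^sup>2) (at (P x)))"
      by (rule has_derivative_linear[OF D])
    moreover have "x \<bullet> ?V x = 0"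
      using tangential_inner[OF tang, of x] by (simp add: inner_commute)
    ultimately show ?thesis
      unfolding \<phi>_def[abs_def] frechet_derivative_at[OF has_derivative_compose[OF DP D], symmetric]
      by (simp add: linear_0)
  qed
  have C1W: "C1_on W UNIV"
  \<comment> \<open>Near the origin, where the extensions need not be regular, the cutoff makes
    \<open>W\<close> vanish identically.\<close>
  proof (rule C1_on_locally)
    fix x :: 'a
    show "\<exists>T. open T \<and> x \<in> T \<and> C1_on W T"
    proof (cases "x = 0")
      case True
      have "C1_on W (ball 0 1)"
        by (rule C1_on_cong[OF C1_on_const[of 0]]) (auto simp: W_def \<phi>0)
      then show ?thesis
        using True by (intro exI[of _ "ball 0 1"]) simp
    next
      case False
      have "C1_on W (- {0})"
        unfolding W_def[abs_def]
        by (intro C1_on_scaleR C1_on_mult C1 C1f C1_on_subset[OF C1\<phi>]) simp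
      then show ?thesis
        using False by (intro exI[of _ "- {0}"]) auto
    qed
  qed
  have divW: "divergence W x = (1 - \<alpha>) * g x" for x
  proof (cases "norm x < 1")
    case True
    have "(W has_derivative (\<lambda>_. 0)) (at x)"
      by (rule has_derivative_transform_within_open[of "\<lambda>_. 0" _ _ _ "ball 0 1"])
        (use True in \<open>auto simp: W_def \<phi>0\<close>)
    from frechet_derivative_at[OF this, symmetric] show ?thesis
      using True by (simp add: divergence_def g_def \<phi>0)
  next
    case False
    then have "x \<noteq> 0" by auto
    then have F: "(?F has_derivative frechet_derivative ?F (at x)) (at x)"
      using C1_on_has_derivative[OF C1f] by simp
    have "((\<lambda>z. \<phi> z * ?F z) has_derivative
        (\<lambda>\<xi>. \<phi> x * frechet_derivative ?F (at x) \<xi> + frechet_derivative \<phi> (at x) \<xi> * ?F x)) (at x)"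
      using C1_on_has_derivative[OF C1\<phi>] F by (intro has_derivative_mult) auto
    moreover have "?V differentiable at x"
      using C1_on_differentiable[OF C1] \<open>x \<noteq> 0\<close> by simp
    ultimately have "divergence W x = \<phi> x * frechet_derivative ?F (at x) (?V x)"
      unfolding W_def[abs_def]
      by (simp add: divergence_scaleR D\<phi> divergence_radial_extension[OF C1 geo \<open>x \<noteq> 0\<close>])
    then show ?thesis
      by (simp add: g_def geodesible_radial_component[OF C1 C1f tang \<open>x \<noteq> 0\<close> u])
  qed
  have supp: "W x = 0" if "norm x > 2" for x
    using that by (simp add: W_def \<phi>0)
  have "integrable lborel (\<lambda>x. (1 - \<alpha>) * g x)" "(\<integral>x. (1 - \<alpha>) * g x \<partial>lborel) = 0"
    using integral_divergence_eq_0[OF C1W supp] unfolding divW[abs_def] by simp_all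
  then have "integrable lborel g" "integral\<^sup>L lborel g = 0"
    using \<open>\<alpha> \<noteq> 1\<close> by simp_all
  moreover have "g x \<ge> 0" for x
    by (simp add: g_def \<phi>_def)
  moreover have "open (- {0 :: 'a})"
    by (simp add: open_Compl)
  moreover have "continuous_on (- {0}) g"
    unfolding g_def
    by (intro continuous_intros C1_on_continuous_on[OF C1] C1_on_continuous_on[OF C1_on_subset[OF C1\<phi>]]) auto
  \<comment> \<open>This point lies on the ray of \<open>y\<close> inside the shell, where
    \<open>P\<close> takes the value \<open>(5/4) * (7/4)\<close>.\<close>
  moreover have "(3/2) *\<^sub>R y \<in> - {0}"
    using y by auto
  ultimately have "g ((3/2) *\<^sub>R y) = 0"
    by (rule continuous_integral_eq_0_imp_eq_0)
  moreover have "y \<bullet> y = 1" "sgn ((3/2) *\<^sub>R y) = y" "norm y = 1"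
    using y by (simp_all add: power2_norm_eq_inner[symmetric] sgn_scaleR) (simp add: sgn_div_norm)
  then have "g ((3/2) *\<^sub>R y) \<noteq> 0"
    using y by (simp add: g_def \<phi>_def P_def)
  ultimately show False by simp
qed

theorem theorem1p3:
  fixes v :: "real ^ 'n \<Rightarrow> real ^ 'n" and \<alpha> :: real
  assumes "CARD('n) \<ge> 4"
    and "C1_on_sphere v"
    and "tangential v"
    and "sphere_geodesible v"
    and "\<exists>y\<in>unit_sphere. v y \<noteq> 0"
  shows "(\<exists>(f :: real ^ 'n \<Rightarrow> real) (q :: real ^ 'n \<Rightarrow> real).
            C1_on_sphere f \<and> C1_on_sphere q \<and>
            (let u = (\<lambda>x. (1 / norm x powr \<alpha>) *\<^sub>R (v (sgn x) + f (sgn x) *\<^sub>R sgn x));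
                 p = (\<lambda>x. (1 / norm x powr (2 * \<alpha>)) * q (sgn x))
             in steady_euler_on (- {0}) u p \<and> geodesible_on (- {0}) u))
         \<longleftrightarrow> \<alpha> = 1"
    (is "?L \<longleftrightarrow> _")
proof
  assume ?L
  then obtain f :: "real ^ 'n \<Rightarrow> real" where "C1_on_sphere f"
    and "geodesible_on (- {0}) (\<lambda>x. (1 / norm x powr \<alpha>) *\<^sub>R (v (sgn x) + f (sgn x) *\<^sub>R sgn x))"
    unfolding Let_def by (elim exE conjE)
  then show "\<alpha> = 1"
    using assms(2-5) by (auto intro: geodesible_degree_unique C1_on_radial_extension)
next
  assume [simp]: "\<alpha> = 1"
  have "C1_on_sphere (\<lambda>_ :: real ^ 'n. 0 :: real)"
    unfolding C1_on_sphere_def by (auto intro!: exI[of _ UNIV] exI[of _ "\<lambda>_. 0"] C1_on_const)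
  with geodesible_euler_degree_minus_one[OF assms(2-4)] C1_on_sphere_minus_half_norm_sq[OF assms(2)]
  show ?L
    by (intro exI[of _ "\<lambda>_. 0"] exI[of _ "\<lambda>y. - (1/2) * (norm (v y))\<^sup>2"]) (simp add: Let_def)
qed

end
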